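(* Let $X_1,X_2$ be compact metric spaces, $\phi_i\colon\mathbb{T}^+\times X_i\to X_i$ ($i=1,2$) dynamical systems, and $\Phi=\phi_1\times\phi_2$ the product system. Let $L_1=\{A_1\times\mathrm{Inv}(X_2)\mid A_1\in\mathsf{Att}(\phi_1)\}$ and $L_2=\{\mathrm{Inv}(X_1)\times A_2\mid A_2\in\mathsf{Att}(\phi_2)\}$, let $L_\wedge=\{A_1\times A_2\mid A_i\in\mathsf{Att}(\phi_i)\}$, and let $L_\wedge^\vee$ be the closure of $L_\wedge$ under finite joins in $\mathsf{Att}(\Phi)$. Then $L_\wedge^\vee$ is the sublattice of $\mathsf{Att}(\Phi)$ generated by $L_1$ and $L_2$.
   Context: $\mathbb{T}$ is $\mathbb{Z}$ or $\mathbb{R}$, $\mathbb{T}^+$ its nonnegative part. A dynamical system on a compact metric space $X$ is a continuous map $\phi\colon\mathbb{T}^+\times X\to X$ with $\phi(0,x)=x$, $\phi(t,\phi(s,x))=\phi(t+s,x)$ (not assumed injective or surjective). The product system is $\Phi(t,(x_1,x_2))=(\phi_1(t,x_1),\phi_2(t,x_2))$. $S$ is invariant if $\phi(t,S)=S$ for all $t\ge0$; $\mathrm{Inv}(U)$ is the union of all invariant subsets of $U$. $\omega(U)=\bigcap_{t\ge0}\mathrm{cl}(\phi([t,\infty),U))$. $U$ is an attracting neighborhood if there is $\tau>0$ with $\phi(t,\mathrm{cl}(U))\subset\mathrm{int}(U)$ for all $t\ge\tau$; an attractor is $\omega(U)$ ($=\mathrm{Inv}(U)$) for an attracting neighborhood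 $U$. $\mathsf{Att}(\phi)$ is the bounded distributive lattice of attractors with $A\vee B=A\cup B$, $A\wedge B=\omega(A\cap B)=\mathrm{Inv}(A\cap B)$, minimum $\emptyset$, maximum $\mathrm{Inv}(X)$. All sets in $L_1,L_2,L_\wedge$ are attractors of $\Phi$. *)

theory Defs
  imports "HOL-Analysis.Analysis"
begin

text \<open>
  The time domain is a set \<open>T\<close> of reals, either \<open>\<int>\<close> or \<open>UNIV\<close>; only times in its nonnegative
  part are ever used. A compact metric space is a compact subset \<open>X\<close> of a metric space type
  (so the empty space is allowed), and only values of \<open>\<phi>\<close> on \<open>nonneg T \<times> X\<close> matter.
  Closures and interiors are those of the space \<open>X\<close>, not of the ambient type.
\<close>

definition nonneg :: "real set \<Rightarrow> real set" where
  "nonneg T = {t \<in> T. 0 \<le> t}"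

definition dynamical_system ::
    "real set \<Rightarrow> 'a::metric_space set \<Rightarrow> (real \<Rightarrow> 'a \<Rightarrow> 'a) \<Rightarrow> bool" where
  "dynamical_system T X \<phi> \<longleftrightarrow>
     continuous_on (nonneg T \<times> X) (\<lambda>(t, x). \<phi> t x) \<and>
     (\<forall>t\<in>nonneg T. \<forall>x\<in>X. \<phi> t x \<in> X) \<and>
     (\<forall>x\<in>X. \<phi> 0 x = x) \<and>
     (\<forall>t\<in>nonneg T. \<forall>s\<in>nonneg T. \<forall>x\<in>X. \<phi> t (\<phi> s x) = \<phi> (t + s) x)"

definition product_system ::
    "(real \<Rightarrow> 'a \<Rightarrow> 'a) \<Rightarrow> (real \<Rightarrow> 'b \<Rightarrow> 'b) \<Rightarrow> real \<Rightarrow> 'a \<times> 'b \<Rightarrow> 'a \<times> 'b" where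
  "product_system \<phi>1 \<phi>2 t = (\<lambda>(x1, x2). (\<phi>1 t x1, \<phi>2 t x2))"

definition invariant :: "real set \<Rightarrow> (real \<Rightarrow> 'a \<Rightarrow> 'a) \<Rightarrow> 'a set \<Rightarrow> bool" where
  "invariant T \<phi> S \<longleftrightarrow> (\<forall>t\<in>nonneg T. \<phi> t ` S = S)"

definition Inv :: "real set \<Rightarrow> (real \<Rightarrow> 'a \<Rightarrow> 'a) \<Rightarrow> 'a set \<Rightarrow> 'a set" where
  "Inv T \<phi> U = \<Union>{S. S \<subseteq> U \<and> invariant T \<phi> S}"

definition omega_limit ::
    "real set \<Rightarrow> 'a::metric_space set \<Rightarrow> (real \<Rightarrow> 'a \<Rightarrow> 'a) \<Rightarrow> 'a set \<Rightarrow> 'a set" where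
  "omega_limit T X \<phi> U =
     (\<Inter>t\<in>nonneg T. top_of_set X closure_of (\<Union>s\<in>{s \<in> T. t \<le> s}. \<phi> s ` U))"

definition attracting_neighborhood ::
    "real set \<Rightarrow> 'a::metric_space set \<Rightarrow> (real \<Rightarrow> 'a \<Rightarrow> 'a) \<Rightarrow> 'a set \<Rightarrow> bool" where
  "attracting_neighborhood T X \<phi> U \<longleftrightarrow>
     U \<subseteq> X \<and>
     (\<exists>\<tau>\<in>T. \<tau> > 0 \<and>
        (\<forall>t\<in>T. t \<ge> \<tau> \<longrightarrow> \<phi> t ` (top_of_set X closure_of U) \<subseteq> top_of_set X interior_of U))"

definition Att ::
    "real set \<Rightarrow> 'a::metric_space set \<Rightarrow> (real \<Rightarrow> 'a \<Rightarrow> 'a) \<Rightarrow> 'a set set" where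
  "Att T X \<phi> = {omega_limit T X \<phi> U |U. attracting_neighborhood T X \<phi> U}"

definition att_meet ::
    "real set \<Rightarrow> 'a::metric_space set \<Rightarrow> (real \<Rightarrow> 'a \<Rightarrow> 'a) \<Rightarrow> 'a set \<Rightarrow> 'a set \<Rightarrow> 'a set" where
  "att_meet T X \<phi> A B = omega_limit T X \<phi> (A \<inter> B)"

text \<open>
  Sublattices of the bounded lattice of attractors (join \<open>\<union>\<close>, meet \<open>att_meet\<close>) contain its
  bounds \<open>{}\<close> and \<open>Inv T \<phi> X\<close>.
\<close>

definition att_sublattice ::
    "real set \<Rightarrow> 'a::metric_space set \<Rightarrow> (real \<Rightarrow> 'a \<Rightarrow> 'a) \<Rightarrow> 'a set set \<Rightarrow> bool" where
  "att_sublattice T X \<phi> L \<longleftrightarrow>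
     L \<subseteq> Att T X \<phi> \<and> {} \<in> L \<and> Inv T \<phi> X \<in> L \<and>
     (\<forall>A\<in>L. \<forall>B\<in>L. A \<union> B \<in> L \<and> att_meet T X \<phi> A B \<in> L)"

text \<open>The empty join, i.e. the minimum \<open>{}\<close>, counts as a finite join.\<close>

definition finite_joins :: "'a set set \<Rightarrow> 'a set set" where
  "finite_joins L = {\<Union>F |F. finite F \<and> F \<subseteq> L}"

end

theory Submission
  imports Defs
begin

text \<open>
  Everything follows from two facts about \<open>\<omega>\<close> on a compact space: \<open>\<omega>(U)\<close> is always closed and
  invariant, and \<open>\<omega>\<close> fixes closed invariant sets. Together with monotonicity they say that
  \<open>\<omega>(U)\<close>, when contained in \<open>U\<close>, is the largest closed invariant subset of \<open>U\<close>. This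
  description makes \<open>\<omega>\<close> commute with products: in general only
  \<open>\<omega>(U\<^sub>1 \<times> U\<^sub>2) \<subseteq> \<omega>(U\<^sub>1) \<times> \<omega>(U\<^sub>2)\<close> holds, since the two factors may return at
  different times, but if \<open>\<omega>(U\<^sub>i) \<subseteq> U\<^sub>i\<close> then the right-hand side is a closed invariant subset
  of \<open>U\<^sub>1 \<times> U\<^sub>2\<close> and equality holds (\<open>omega_limit_Times\<close>). The condition is met by attracting
  neighborhoods, by intersections of attractors and by the whole space, so
  \<open>A\<^sub>1 \<times> A\<^sub>2\<close> is an attractor, the maximum of the product lattice is
  \<open>Inv(X\<^sub>1) \<times> Inv(X\<^sub>2)\<close>, and
  \<open>(A\<^sub>1 \<times> A\<^sub>2) \<and> (B\<^sub>1 \<times> B\<^sub>2) = (A\<^sub>1 \<and> B\<^sub>1) \<times> (A\<^sub>2 \<and> B\<^sub>2)\<close>.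

  Products of attractors are thus closed under meets. Because \<open>\<omega>\<close> also commutes with finite unions,
  meets distribute over finite joins, so the finite joins of products form a sublattice, which contains
  \<open>L\<^sub>1\<close> and \<open>L\<^sub>2\<close>. Conversely
  \<open>A\<^sub>1 \<times> A\<^sub>2 = (A\<^sub>1 \<times> Inv(X\<^sub>2)) \<and> (Inv(X\<^sub>1) \<times> A\<^sub>2)\<close>, so every
  sublattice containing \<open>L\<^sub>1\<close> and \<open>L\<^sub>2\<close> contains all products and all their finite joins.
\<close>

section \<open>Omega-limit sets in a compact space\<close>

locale compact_system =
  fixes T :: "real set" and X :: "'a::metric_space set" and \<phi> :: "real \<Rightarrow> 'a \<Rightarrow> 'a"
  assumes time: "T = \<int> \<or> T = UNIV"
    and compact_space: "compact X"
    and system: "dynamical_system T X \<phi>"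
begin

definition tail :: "'a set \<Rightarrow> real \<Rightarrow> 'a set" where
  "tail U t = (\<Union>s\<in>{s \<in> T. t \<le> s}. \<phi> s ` U)"

abbreviation omega :: "'a set \<Rightarrow> 'a set" where
  "omega U \<equiv> omega_limit T X \<phi> U"

lemma time_add: "s \<in> T \<Longrightarrow> t \<in> T \<Longrightarrow> s + t \<in> T"
  and time_diff: "s \<in> T \<Longrightarrow> t \<in> T \<Longrightarrow> s - t \<in> T"
  and time_0: "0 \<in> T" and time_1: "1 \<in> T"
  using time by auto

lemma nonneg_0: "0 \<in> nonneg T"
  by (simp add: nonneg_def time_0)

lemma flow_in: "t \<in> nonneg T \<Longrightarrow> x \<in> X \<Longrightarrow> \<phi> t x \<in> X"
  and flow_add: "t \<in> nonneg T \<Longrightarrow> s \<in> nonneg T \<Longrightarrow> x \<in> X \<Longrightarrow> \<phi> t (\<phi> s x) = \<phi> (t + s) x"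
  using system by (auto simp: dynamical_system_def)

lemma continuous_flow:
  assumes "t \<in> nonneg T"
  shows "continuous_on X (\<phi> t)"
proof -
  have "continuous_on (nonneg T \<times> X) (\<lambda>(t, x). \<phi> t x)"
    using system by (simp add: dynamical_system_def)
  then have "continuous_on X ((\<lambda>(t, x). \<phi> t x) \<circ> (\<lambda>x. (t, x)))"
    by (intro continuous_on_compose continuous_intros) (use assms in \<open>auto elim: continuous_on_subset\<close>)
  then show ?thesis by (simp add: o_def)
qed

lemma closed_space: "closed X"
  using compact_space by (rule compact_imp_closed)

lemma closure_of_eq: "U \<subseteq> X \<Longrightarrow> top_of_set X closure_of U = closure U"
  using closure_minimal[OF _ closed_space, of U]
  by (auto simp: closure_of_subtopology Int_absorb1)

lemma tail_subset: "U \<subseteq> X \<Longrightarrow> 0 \<le> t \<Longrightarrow> tail U t \<subseteq> X"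
  by (auto simp: tail_def nonneg_def intro!: flow_in)

lemma tail_antimono: "s \<le> t \<Longrightarrow> tail U t \<subseteq> tail U s"
  by (auto simp: tail_def)

lemma closure_tail_subset: "U \<subseteq> X \<Longrightarrow> 0 \<le> t \<Longrightarrow> closure (tail U t) \<subseteq> X"
  by (simp add: closure_minimal closed_space tail_subset)

lemma omega_eq: "U \<subseteq> X \<Longrightarrow> omega U = (\<Inter>t\<in>nonneg T. closure (tail U t))"
  unfolding omega_limit_def tail_def[symmetric]
  by (intro INF_cong refl closure_of_eq tail_subset) (auto simp: nonneg_def)

lemma omega_subset: "U \<subseteq> X \<Longrightarrow> omega U \<subseteq> X"
  using closure_tail_subset[of U 0] nonneg_0 by (auto simp: omega_eq)

lemma closed_omega: "U \<subseteq> X \<Longrightarrow> closed (omega U)"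
  by (auto simp: omega_eq intro!: closed_INT)

lemma omega_mono:
  assumes "U \<subseteq> V" "V \<subseteq> X"
  shows "omega U \<subseteq> omega V"
proof -
  have "closure (tail U t) \<subseteq> closure (tail V t)" for t
    using assms(1) by (intro closure_mono) (auto simp: tail_def)
  then show ?thesis using assms by (fastforce simp: omega_eq)
qed

lemma flow_tail:
  assumes "U \<subseteq> X" "s \<in> nonneg T" "t \<in> nonneg T"
  shows "\<phi> t ` tail U s = tail U (s + t)"
proof (intro equalityI subsetI)
  fix y assume "y \<in> \<phi> t ` tail U s"
  then obtain r u where r: "r \<in> T" "s \<le> r" "u \<in> U" "y = \<phi> t (\<phi> r u)"
    by (auto simp: tail_def)
  then have "y = \<phi> (t + r) u" "t + r \<in> T"
    using assms by (auto simp: flow_add nonneg_def subset_iff time_add)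
  then show "y \<in> tail U (s + t)" using r by (auto simp: tail_def intro!: bexI[of _ "t + r"])
next
  fix y assume "y \<in> tail U (s + t)"
  then obtain r u where r: "r \<in> T" "s + t \<le> r" "u \<in> U" "y = \<phi> r u"
    by (auto simp: tail_def)
  have rt: "r - t \<in> T" using r assms by (auto simp: time_diff nonneg_def)
  have "\<phi> t (\<phi> (r - t) u) = y"
    using r assms rt by (subst flow_add) (auto simp: nonneg_def)
  moreover have "\<phi> (r - t) u \<in> tail U s" using r rt by (auto simp: tail_def intro!: bexI[of _ "r - t"])
  ultimately show "y \<in> \<phi> t ` tail U s" by blast
qed

text \<open>
  Since \<open>\<phi> t\<close> maps the tail from \<open>s\<close> onto the tail from \<open>s + t\<close>, a compact image of a closed
  tail contains a later closed tail. So each point of \<open>\<omega>(U)\<close> has preimages in all closed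
  tails, and by compactness a common one.
\<close>

lemma invariant_omega:
  assumes U: "U \<subseteq> X"
  shows "invariant T \<phi> (omega U)"
  unfolding invariant_def
proof (intro ballI equalityI)
  fix t assume t: "t \<in> nonneg T"
  show "\<phi> t ` omega U \<subseteq> omega U"
  proof -
    have "\<phi> t y \<in> closure (tail U s)" if y: "y \<in> omega U" and s: "s \<in> nonneg T" for y s
    proof -
      have "y \<in> closure (tail U s)" using y s U by (auto simp: omega_eq)
      moreover have "continuous_on (closure (tail U s)) (\<phi> t)"
        using continuous_on_subset[OF continuous_flow[OF t] closure_tail_subset[OF U]] s
        by (simp add: nonneg_def)
      moreover have "\<phi> t ` tail U s \<subseteq> closure (tail U s)"
        using flow_tail[OF U s t] tail_antimono[of s "s + t" U] t closure_subset
        by (force simp: nonneg_def)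
      ultimately show ?thesis
        using image_closure_subset[of "tail U s" "\<phi> t" "closure (tail U s)"] by auto
    qed
    then show ?thesis using U by (auto simp: omega_eq)
  qed
  show "omega U \<subseteq> \<phi> t ` omega U"
  proof
    fix y assume y: "y \<in> omega U"
    define P where "P s = {x \<in> closure (tail U s). \<phi> t x = y}" for s
    have closed_tail: "compact (closure (tail U s))" "continuous_on (closure (tail U s)) (\<phi> t)"
      if "s \<in> nonneg T" for s
    proof -
      have "closure (tail U s) \<subseteq> X" using closure_tail_subset[OF U] that by (simp add: nonneg_def)
      then show "compact (closure (tail U s))" "continuous_on (closure (tail U s)) (\<phi> t)"
        using compact_Int_closed[OF compact_space closed_closure, of "tail U s"]
          continuous_on_subset[OF continuous_flow[OF t]]
        by (auto simp: Int_absorb1)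
    qed
    have nonempty: "P s \<noteq> {}" if s: "s \<in> nonneg T" for s
    proof -
      have "closed (\<phi> t ` closure (tail U s))"
        using closed_tail[OF s] compact_continuous_image compact_imp_closed by blast
      then have "closure (tail U (s + t)) \<subseteq> \<phi> t ` closure (tail U s)"
        using flow_tail[OF U s t] closure_subset[of "tail U s"] by (intro closure_minimal) auto
      moreover have "s + t \<in> nonneg T" using s t by (auto simp: nonneg_def time_add)
      ultimately show ?thesis using y U by (auto simp: omega_eq P_def)
    qed
    have "X \<inter> \<Inter>(P ` nonneg T) \<noteq> {}"
    proof (rule compact_imp_fip[OF compact_space])
      show "closed S" if "S \<in> P ` nonneg T" for S
      proof -
        obtain s where s: "s \<in> nonneg T" "S = P s" using \<open>S \<in> P ` nonneg T\<close> by auto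
        then show ?thesis unfolding s P_def
          using continuous_closed_preimage_constant[OF closed_tail(2)[OF s(1)]] by simp
      qed
      show "X \<inter> \<Inter>F' \<noteq> {}" if F': "finite F'" "F' \<subseteq> P ` nonneg T" for F'
      proof -
        obtain N where N: "finite N" "N \<subseteq> nonneg T" "F' = P ` N"
          using finite_subset_image[OF F'] by auto
        \<comment> \<open>The sets \<open>P s\<close> decrease with \<open>s\<close>, so the latest time suffices; \<open>0\<close> covers empty \<open>N\<close>.\<close>
        define m where "m = Max (insert 0 N)"
        have m: "m \<in> nonneg T" using N nonneg_0 Max_in[of "insert 0 N"] by (auto simp: m_def)
        obtain x where x: "x \<in> P m" using nonempty[OF m] by auto
        have "x \<in> P s" if "s \<in> N" for s
        proof -
          have "s \<le> m" using that N by (auto simp: m_def)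
          then show ?thesis using x closure_mono[OF tail_antimono[of s m U]] by (auto simp: P_def)
        qed
        moreover have "x \<in> X"
          using x closure_tail_subset[OF U, of m] m by (auto simp: P_def nonneg_def)
        ultimately show ?thesis using N by auto
      qed
    qed
    then obtain x where x: "\<And>s. s \<in> nonneg T \<Longrightarrow> x \<in> P s" by auto
    then have "x \<in> omega U" "\<phi> t x = y" using U x[OF nonneg_0] by (auto simp: omega_eq P_def)
    then show "y \<in> \<phi> t ` omega U" by blast
  qed
qed

lemma invariant_tail:
  assumes "invariant T \<phi> S" "t \<in> nonneg T"
  shows "tail S t = S"
proof -
  have "\<phi> s ` S = S" if "s \<in> T" "t \<le> s" for s
    using assms that by (auto simp: invariant_def nonneg_def)
  then show ?thesis using assms(2) by (force simp: tail_def nonneg_def)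
qed

lemma invariant_subset_omega:
  assumes "S \<subseteq> X" "invariant T \<phi> S"
  shows "S \<subseteq> omega S"
  using assms closure_subset by (auto simp: omega_eq invariant_tail)

lemma omega_closed_invariant:
  assumes "S \<subseteq> X" "invariant T \<phi> S" "closed S"
  shows "omega S = S"
  using assms nonneg_0 by (auto simp: omega_eq invariant_tail)

lemma omega_subset_self:
  assumes "U \<subseteq> X" "closed U" "\<And>t. t \<in> nonneg T \<Longrightarrow> \<phi> t ` U \<subseteq> U"
  shows "omega U \<subseteq> U"
proof -
  have "tail U 0 \<subseteq> U" using assms(3) by (auto simp: tail_def nonneg_def)
  then have "closure (tail U 0) \<subseteq> U" using assms(2) by (rule closure_minimal)
  then show ?thesis using assms(1) nonneg_0 by (auto simp: omega_eq)
qed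

lemma Inv_space_eq_omega: "Inv T \<phi> X = omega X"
proof (intro equalityI)
  show "Inv T \<phi> X \<subseteq> omega X"
    using invariant_subset_omega omega_mono[OF _ subset_refl] unfolding Inv_def by blast
  show "omega X \<subseteq> Inv T \<phi> X"
    using omega_subset invariant_omega unfolding Inv_def by blast
qed

lemma omega_empty: "omega {} = {}"
  using nonneg_0 by (auto simp: omega_eq tail_def)

text \<open>
  A point outside both limits leaves each closed tail at some time, hence both at the later
  of these two times.
\<close>

lemma omega_Un:
  assumes "U \<subseteq> X" "V \<subseteq> X"
  shows "omega (U \<union> V) = omega U \<union> omega V"
proof (intro equalityI)
  show "omega U \<union> omega V \<subseteq> omega (U \<union> V)" using assms by (simp add: omega_mono)
  show "omega (U \<union> V) \<subseteq> omega U \<union> omega V"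
  proof (intro subsetI, rule ccontr)
    fix y assume y: "y \<in> omega (U \<union> V)" and n: "y \<notin> omega U \<union> omega V"
    obtain s t where st: "s \<in> nonneg T" "t \<in> nonneg T"
      "y \<notin> closure (tail U s)" "y \<notin> closure (tail V t)"
      using n assms by (auto simp: omega_eq)
    have "max s t \<in> nonneg T" using st by (auto simp: max_def)
    moreover have "tail (U \<union> V) (max s t) = tail U (max s t) \<union> tail V (max s t)"
      by (auto simp: tail_def)
    ultimately have "y \<in> closure (tail U (max s t)) \<union> closure (tail V (max s t))"
      using y assms by (auto simp: omega_eq)
    then show False
      using st closure_mono[OF tail_antimono[of s "max s t" U]]
        closure_mono[OF tail_antimono[of t "max s t" V]] by auto
  qed
qed

lemma omega_UN:
  assumes "finite I" "\<And>i. i \<in> I \<Longrightarrow> V i \<subseteq> X"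
  shows "omega (\<Union>i\<in>I. V i) = (\<Union>i\<in>I. omega (V i))"
  using assms
proof (induction I)
  case (insert i I)
  then have "omega (V i \<union> (\<Union>i\<in>I. V i)) = omega (V i) \<union> omega (\<Union>i\<in>I. V i)"
    by (intro omega_Un) auto
  then show ?case using insert by simp
qed (simp add: omega_empty)

section \<open>Attractors\<close>

text \<open>
  A priori \<open>\<omega>(U)\<close> lies only in the closure of \<open>U\<close>; flowing for time \<open>\<tau>\<close> moves the closure
  into the interior but, by invariance, leaves \<open>\<omega>(U)\<close> in place.
\<close>

lemma omega_subset_attracting_neighborhood:
  assumes "attracting_neighborhood T X \<phi> U"
  shows "omega U \<subseteq> U"
proof -
  obtain \<tau> where U: "U \<subseteq> X" and \<tau>: "\<tau> \<in> T" "\<tau> > 0"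
    and attr: "\<And>t. t \<in> T \<Longrightarrow> t \<ge> \<tau> \<Longrightarrow> \<phi> t ` (top_of_set X closure_of U) \<subseteq> top_of_set X interior_of U"
    using assms by (auto simp: attracting_neighborhood_def)
  have \<tau>': "\<tau> \<in> nonneg T" using \<tau> by (simp add: nonneg_def)
  have "tail U \<tau> \<subseteq> U"
    using attr closure_subset[of U] U interior_of_subset[of "top_of_set X" U]
    by (fastforce simp: tail_def closure_of_eq)
  then have "omega U \<subseteq> closure U"
    using U \<tau>' closure_mono[of "tail U \<tau>" U] by (auto simp: omega_eq)
  then have "\<phi> \<tau> ` omega U \<subseteq> U"
    using attr[OF \<tau>(1)] U interior_of_subset[of "top_of_set X" U] by (auto simp: closure_of_eq)
  then show ?thesis using invariant_omega[OF U] \<tau>' by (auto simp: invariant_def)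
qed

lemma
  assumes "A \<in> Att T X \<phi>"
  shows Att_subset: "A \<subseteq> X" and Att_closed: "closed A" and Att_invariant: "invariant T \<phi> A"
  using assms omega_subset closed_omega invariant_omega
  by (auto simp: Att_def attracting_neighborhood_def)

lemma Att_omega: "A \<in> Att T X \<phi> \<Longrightarrow> omega A = A"
  by (intro omega_closed_invariant Att_subset Att_invariant Att_closed)

lemma omega_Att_Int_subset:
  assumes "A \<in> Att T X \<phi>" "B \<in> Att T X \<phi>"
  shows "omega (A \<inter> B) \<subseteq> A \<inter> B"
proof (rule omega_subset_self)
  show "A \<inter> B \<subseteq> X" using Att_subset assms by blast
  show "closed (A \<inter> B)" using Att_closed assms by (simp add: closed_Int)
  show "\<phi> t ` (A \<inter> B) \<subseteq> A \<inter> B" if "t \<in> nonneg T" for t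
    using Att_invariant[OF assms(1)] Att_invariant[OF assms(2)] that unfolding invariant_def by blast
qed

lemma attracting_neighborhoodE:
  assumes "attracting_neighborhood T X \<phi> U"
  obtains \<tau> where "U \<subseteq> X" "\<tau> \<in> T" "\<tau> > 0"
    "\<And>t. t \<in> T \<Longrightarrow> t \<ge> \<tau> \<Longrightarrow> \<phi> t ` closure U \<subseteq> top_of_set X interior_of U"
  using assms closure_of_eq unfolding attracting_neighborhood_def by metis

lemma attracting_neighborhoodI:
  assumes "U \<subseteq> X" "\<tau> \<in> T" "\<tau> > 0"
    "\<And>t. t \<in> T \<Longrightarrow> t \<ge> \<tau> \<Longrightarrow> \<phi> t ` closure U \<subseteq> top_of_set X interior_of U"
  shows "attracting_neighborhood T X \<phi> U"
  using assms closure_of_eq unfolding attracting_neighborhood_def by metis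

lemma attracting_neighborhood_Un:
  assumes "attracting_neighborhood T X \<phi> U" "attracting_neighborhood T X \<phi> V"
  shows "attracting_neighborhood T X \<phi> (U \<union> V)"
proof -
  obtain \<sigma> where \<sigma>: "U \<subseteq> X" "\<sigma> \<in> T" "\<sigma> > 0"
    "\<And>t. t \<in> T \<Longrightarrow> t \<ge> \<sigma> \<Longrightarrow> \<phi> t ` closure U \<subseteq> top_of_set X interior_of U"
    by (rule attracting_neighborhoodE[OF assms(1)]) blast
  obtain \<tau> where \<tau>: "V \<subseteq> X" "\<tau> \<in> T" "\<tau> > 0"
    "\<And>t. t \<in> T \<Longrightarrow> t \<ge> \<tau> \<Longrightarrow> \<phi> t ` closure V \<subseteq> top_of_set X interior_of V"
    by (rule attracting_neighborhoodE[OF assms(2)]) blast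
  have int: "top_of_set X interior_of U \<union> top_of_set X interior_of V
      \<subseteq> top_of_set X interior_of (U \<union> V)"
    by (simp add: interior_of_mono)
  show ?thesis
  proof (rule attracting_neighborhoodI[of _ "max \<sigma> \<tau>"])
    show "\<phi> t ` closure (U \<union> V) \<subseteq> top_of_set X interior_of (U \<union> V)"
      if "t \<in> T" "t \<ge> max \<sigma> \<tau>" for t
      using \<sigma>(4)[of t] \<tau>(4)[of t] int that by (auto simp: image_Un)
  qed (use \<sigma> \<tau> in \<open>auto simp: max_def\<close>)
qed

lemma attracting_neighborhood_Int:
  assumes "attracting_neighborhood T X \<phi> U" "attracting_neighborhood T X \<phi> V"
  shows "attracting_neighborhood T X \<phi> (U \<inter> V)"
proof -
  obtain \<sigma> where \<sigma>: "U \<subseteq> X" "\<sigma> \<in> T" "\<sigma> > 0"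
    "\<And>t. t \<in> T \<Longrightarrow> t \<ge> \<sigma> \<Longrightarrow> \<phi> t ` closure U \<subseteq> top_of_set X interior_of U"
    by (rule attracting_neighborhoodE[OF assms(1)]) blast
  obtain \<tau> where \<tau>: "V \<subseteq> X" "\<tau> \<in> T" "\<tau> > 0"
    "\<And>t. t \<in> T \<Longrightarrow> t \<ge> \<tau> \<Longrightarrow> \<phi> t ` closure V \<subseteq> top_of_set X interior_of V"
    by (rule attracting_neighborhoodE[OF assms(2)]) blast
  have cl: "closure (U \<inter> V) \<subseteq> closure U" "closure (U \<inter> V) \<subseteq> closure V"
    by (simp_all add: closure_mono)
  show ?thesis
  proof (rule attracting_neighborhoodI[of _ "max \<sigma> \<tau>"])
    show "\<phi> t ` closure (U \<inter> V) \<subseteq> top_of_set X interior_of (U \<inter> V)"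
      if "t \<in> T" "t \<ge> max \<sigma> \<tau>" for t
      using image_mono[OF cl(1), of "\<phi> t"] image_mono[OF cl(2), of "\<phi> t"] \<sigma>(4)[of t] \<tau>(4)[of t] that
      by (simp add: interior_of_Int) blast
  qed (use \<sigma> \<tau> in \<open>auto simp: max_def\<close>)
qed

lemma Att_empty: "{} \<in> Att T X \<phi>"
proof -
  have "attracting_neighborhood T X \<phi> {}"
    by (rule attracting_neighborhoodI[of _ 1]) (auto simp: time_1)
  then show ?thesis unfolding Att_def using omega_empty by blast
qed

lemma Att_Inv_space: "Inv T \<phi> X \<in> Att T X \<phi>"
proof -
  have int: "top_of_set X interior_of X = X" using interior_of_topspace[of "top_of_set X"] by simp
  have "attracting_neighborhood T X \<phi> X"
    by (rule attracting_neighborhoodI[of _ 1])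
      (auto simp: time_1 int closure_closed[OF closed_space] nonneg_def intro!: flow_in)
  then show ?thesis unfolding Att_def Inv_space_eq_omega by blast
qed

lemma Att_subset_Inv_space: "A \<in> Att T X \<phi> \<Longrightarrow> A \<subseteq> Inv T \<phi> X"
  using Att_subset Att_invariant unfolding Inv_def by blast

lemma Att_Un:
  assumes "A \<in> Att T X \<phi>" "B \<in> Att T X \<phi>"
  shows "A \<union> B \<in> Att T X \<phi>"
proof -
  obtain U V where UV: "attracting_neighborhood T X \<phi> U" "A = omega U"
    "attracting_neighborhood T X \<phi> V" "B = omega V"
    using assms unfolding Att_def by blast
  have "A \<union> B = omega (U \<union> V)"
    using UV by (simp add: omega_Un attracting_neighborhood_def)
  then show ?thesis unfolding Att_def using attracting_neighborhood_Un UV by blast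
qed

lemma Att_Union: "finite F \<Longrightarrow> F \<subseteq> Att T X \<phi> \<Longrightarrow> \<Union>F \<in> Att T X \<phi>"
  by (induction F rule: finite_induct) (auto simp: Att_empty Att_Un)

text \<open>
  If \<open>A = \<omega>(U)\<close> and \<open>B = \<omega>(V)\<close> then \<open>\<omega>(A \<inter> B) = \<omega>(U \<inter> V)\<close>: the inclusion
  \<open>A \<inter> B \<subseteq> U \<inter> V\<close> gives one half, and \<open>\<omega>(U \<inter> V)\<close> is a closed invariant subset
  of \<open>A \<inter> B\<close>.
\<close>

lemma Att_meet:
  assumes "A \<in> Att T X \<phi>" "B \<in> Att T X \<phi>"
  shows "omega (A \<inter> B) \<in> Att T X \<phi>"
proof -
  obtain U V where UV: "attracting_neighborhood T X \<phi> U" "A = omega U"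
    "attracting_neighborhood T X \<phi> V" "B = omega V"
    using assms unfolding Att_def by blast
  have sub: "U \<subseteq> X" "V \<subseteq> X" "U \<inter> V \<subseteq> X" "A \<inter> B \<subseteq> X"
    using UV Att_subset[OF assms(1)] by (auto simp: attracting_neighborhood_def)
  have "A \<inter> B \<subseteq> U \<inter> V" using UV omega_subset_attracting_neighborhood by blast
  then have "omega (A \<inter> B) \<subseteq> omega (U \<inter> V)" using sub by (simp add: omega_mono)
  moreover have "omega (U \<inter> V) = omega (omega (U \<inter> V))"
    using sub omega_closed_invariant omega_subset invariant_omega closed_omega by simp
  moreover have "omega (U \<inter> V) \<subseteq> A \<inter> B" using UV sub by (simp add: omega_mono)
  then have "omega (omega (U \<inter> V)) \<subseteq> omega (A \<inter> B)" using sub by (simp add: omega_mono)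
  ultimately have "omega (A \<inter> B) = omega (U \<inter> V)" by auto
  then show ?thesis unfolding Att_def using attracting_neighborhood_Int UV by blast
qed

end

section \<open>Finite joins of attractors\<close>

lemma finite_joins_incl: "L \<subseteq> finite_joins L"
proof
  fix A assume "A \<in> L"
  then have "A = \<Union>{A} \<and> finite {A} \<and> {A} \<subseteq> L" by simp
  then show "A \<in> finite_joins L" unfolding finite_joins_def by blast
qed

lemma finite_joins_Un:
  assumes "A \<in> finite_joins L" "B \<in> finite_joins L"
  shows "A \<union> B \<in> finite_joins L"
proof -
  obtain F G where "A = \<Union>F" "finite F" "F \<subseteq> L" "B = \<Union>G" "finite G" "G \<subseteq> L"
    using assms unfolding finite_joins_def by blast
  then have "A \<union> B = \<Union>(F \<union> G)" "finite (F \<union> G)" "F \<union> G \<subseteq> L" by auto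
  then show ?thesis unfolding finite_joins_def by (intro CollectI exI[of _ "F \<union> G"] conjI)
qed

lemma finite_joins_subset:
  assumes "att_sublattice T X \<phi> S" "L \<subseteq> S"
  shows "finite_joins L \<subseteq> S"
proof -
  have "\<Union>F \<in> S" if "finite F" "F \<subseteq> L" for F
    using that
  proof (induction F rule: finite_induct)
    case empty
    then show ?case using assms by (simp add: att_sublattice_def)
  next
    case (insert A F)
    then show ?case using assms by (auto simp: att_sublattice_def)
  qed
  then show ?thesis unfolding finite_joins_def by blast
qed

text \<open>Joins are unions and \<open>\<omega>\<close> commutes with finite unions, so meets distribute over finite joins.\<close>

lemma (in compact_system) att_sublattice_finite_joins:
  assumes L: "L \<subseteq> Att T X \<phi>" and top: "Inv T \<phi> X \<in> L"
    and meet: "\<And>A B. A \<in> L \<Longrightarrow> B \<in> L \<Longrightarrow> omega (A \<inter> B) \<in> L"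
  shows "att_sublattice T X \<phi> (finite_joins L)"
  unfolding att_sublattice_def
proof (intro conjI ballI)
  show "finite_joins L \<subseteq> Att T X \<phi>"
    using L Att_Union unfolding finite_joins_def by blast
  show "{} \<in> finite_joins L" unfolding finite_joins_def by blast
  show "Inv T \<phi> X \<in> finite_joins L" using top finite_joins_incl by blast
  fix A B assume AB: "A \<in> finite_joins L" "B \<in> finite_joins L"
  then show "A \<union> B \<in> finite_joins L" by (rule finite_joins_Un)
  obtain F G where FG: "A = \<Union>F" "finite F" "F \<subseteq> L" "B = \<Union>G" "finite G" "G \<subseteq> L"
    using AB unfolding finite_joins_def by blast
  have "omega (\<Union>(C, D)\<in>F \<times> G. C \<inter> D) = (\<Union>p\<in>F \<times> G. omega (case p of (C, D) \<Rightarrow> C \<inter> D))"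
  proof (rule omega_UN)
    show "(case p of (C, D) \<Rightarrow> C \<inter> D) \<subseteq> X" if "p \<in> F \<times> G" for p
      using that FG L Att_subset by fastforce
  qed (use FG in simp)
  moreover have "A \<inter> B = (\<Union>(C, D)\<in>F \<times> G. C \<inter> D)" using FG by auto
  ultimately have "att_meet T X \<phi> A B = \<Union>((\<lambda>(C, D). omega (C \<inter> D)) ` (F \<times> G))"
    by (simp add: att_meet_def case_prod_unfold)
  moreover have "(\<lambda>(C, D). omega (C \<inter> D)) ` (F \<times> G) \<subseteq> L" using FG meet by auto
  ultimately show "att_meet T X \<phi> A B \<in> finite_joins L"
    unfolding finite_joins_def using FG by blast
qed

section \<open>Products\<close>

lemma dynamical_system_product:
  assumes "dynamical_system T X1 \<phi>1" "dynamical_system T X2 \<phi>2"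
  shows "dynamical_system T (X1 \<times> X2) (product_system \<phi>1 \<phi>2)"
proof -
  have c1: "continuous_on (nonneg T \<times> X1) (\<lambda>(t, x). \<phi>1 t x)"
    and c2: "continuous_on (nonneg T \<times> X2) (\<lambda>(t, x). \<phi>2 t x)"
    using assms by (auto simp: dynamical_system_def)
  have "continuous_on (nonneg T \<times> X1 \<times> X2)
      (\<lambda>p. ((\<lambda>(t, x). \<phi>1 t x) (fst p, fst (snd p)), (\<lambda>(t, x). \<phi>2 t x) (fst p, snd (snd p))))"
    by (intro continuous_on_Pair continuous_on_compose2[OF c1] continuous_on_compose2[OF c2]
        continuous_intros) auto
  then have "continuous_on (nonneg T \<times> X1 \<times> X2) (\<lambda>(t, x). product_system \<phi>1 \<phi>2 t x)"
    by (simp add: product_system_def case_prod_unfold)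
  then show ?thesis using assms by (auto simp: dynamical_system_def product_system_def)
qed

lemma product_system_image: "product_system \<phi>1 \<phi>2 t ` (A \<times> B) = \<phi>1 t ` A \<times> \<phi>2 t ` B"
  by (auto simp: product_system_def image_iff)

lemma invariant_Times:
  "invariant T \<phi>1 A \<Longrightarrow> invariant T \<phi>2 B \<Longrightarrow> invariant T (product_system \<phi>1 \<phi>2) (A \<times> B)"
  by (simp add: invariant_def product_system_image)

locale product_of_compact_systems =
  fst: compact_system T X1 \<phi>1 + snd: compact_system T X2 \<phi>2
  for T :: "real set" and X1 :: "'a::metric_space set" and X2 :: "'b::metric_space set"
    and \<phi>1 :: "real \<Rightarrow> 'a \<Rightarrow> 'a" and \<phi>2 :: "real \<Rightarrow> 'b \<Rightarrow> 'b"
begin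

sublocale prod: compact_system T "X1 \<times> X2" "product_system \<phi>1 \<phi>2"
  by unfold_locales
    (use fst.time fst.compact_space snd.compact_space fst.system snd.system in
      \<open>simp_all add: compact_Times dynamical_system_product\<close>)

text \<open>
  The right-hand side is closed, invariant and contained in \<open>U1 \<times> U2\<close>, so \<open>\<omega>\<close> fixes it and
  monotonicity gives the inclusion that fails for arbitrary \<open>U1\<close> and \<open>U2\<close>.
\<close>

lemma omega_limit_Times:
  assumes U: "U1 \<subseteq> X1" "U2 \<subseteq> X2"
    and self: "fst.omega U1 \<subseteq> U1" "snd.omega U2 \<subseteq> U2"
  shows "prod.omega (U1 \<times> U2) = fst.omega U1 \<times> snd.omega U2"
proof (intro equalityI)
  have UX: "U1 \<times> U2 \<subseteq> X1 \<times> X2" using U by blast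
  have "closure (prod.tail (U1 \<times> U2) t) \<subseteq> closure (fst.tail U1 t) \<times> closure (snd.tail U2 t)" for t
    unfolding closure_Times[symmetric]
    by (intro closure_mono)
      (auto simp: fst.tail_def snd.tail_def prod.tail_def product_system_def)
  then show "prod.omega (U1 \<times> U2) \<subseteq> fst.omega U1 \<times> snd.omega U2"
    using U by (fastforce simp: fst.omega_eq snd.omega_eq prod.omega_eq[OF UX])
  have "fst.omega U1 \<times> snd.omega U2 \<subseteq> X1 \<times> X2"
    using fst.omega_subset snd.omega_subset U by blast
  then have "prod.omega (fst.omega U1 \<times> snd.omega U2) = fst.omega U1 \<times> snd.omega U2"
    using U by (intro prod.omega_closed_invariant invariant_Times fst.invariant_omega
        snd.invariant_omega closed_Times fst.closed_omega snd.closed_omega)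
  moreover have "prod.omega (fst.omega U1 \<times> snd.omega U2) \<subseteq> prod.omega (U1 \<times> U2)"
    using self UX by (intro prod.omega_mono) auto
  ultimately show "fst.omega U1 \<times> snd.omega U2 \<subseteq> prod.omega (U1 \<times> U2)" by simp
qed

lemma Inv_Times: "Inv T (product_system \<phi>1 \<phi>2) (X1 \<times> X2) = Inv T \<phi>1 X1 \<times> Inv T \<phi>2 X2"
  unfolding fst.Inv_space_eq_omega snd.Inv_space_eq_omega prod.Inv_space_eq_omega
  by (intro omega_limit_Times fst.omega_subset snd.omega_subset subset_refl)

lemma attracting_neighborhood_Times:
  assumes "attracting_neighborhood T X1 \<phi>1 U1" "attracting_neighborhood T X2 \<phi>2 U2"
  shows "attracting_neighborhood T (X1 \<times> X2) (product_system \<phi>1 \<phi>2) (U1 \<times> U2)"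
proof -
  obtain \<sigma> where \<sigma>: "U1 \<subseteq> X1" "\<sigma> \<in> T" "\<sigma> > 0"
    "\<And>t. t \<in> T \<Longrightarrow> t \<ge> \<sigma> \<Longrightarrow> \<phi>1 t ` closure U1 \<subseteq> top_of_set X1 interior_of U1"
    using assms(1) by (rule fst.attracting_neighborhoodE) blast
  obtain \<tau> where \<tau>: "U2 \<subseteq> X2" "\<tau> \<in> T" "\<tau> > 0"
    "\<And>t. t \<in> T \<Longrightarrow> t \<ge> \<tau> \<Longrightarrow> \<phi>2 t ` closure U2 \<subseteq> top_of_set X2 interior_of U2"
    using assms(2) by (rule snd.attracting_neighborhoodE) blast
  have int: "top_of_set (X1 \<times> X2) interior_of (U1 \<times> U2)
      = (top_of_set X1 interior_of U1) \<times> (top_of_set X2 interior_of U2)"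
    by (metis interior_of_Times prod_topology_subtopology_eu)
  show ?thesis
  proof (rule prod.attracting_neighborhoodI[of _ "max \<sigma> \<tau>"])
    show "product_system \<phi>1 \<phi>2 t ` closure (U1 \<times> U2) \<subseteq> top_of_set (X1 \<times> X2) interior_of (U1 \<times> U2)"
      if "t \<in> T" "t \<ge> max \<sigma> \<tau>" for t
      unfolding int closure_Times product_system_image
      using \<sigma>(4)[of t] \<tau>(4)[of t] that by (intro Sigma_mono) auto
  qed (use \<sigma> \<tau> in \<open>auto simp: max_def\<close>)
qed

lemma Att_Times:
  assumes "A1 \<in> Att T X1 \<phi>1" "A2 \<in> Att T X2 \<phi>2"
  shows "A1 \<times> A2 \<in> Att T (X1 \<times> X2) (product_system \<phi>1 \<phi>2)"
proof -
  obtain U1 U2 where U: "attracting_neighborhood T X1 \<phi>1 U1" "A1 = fst.omega U1"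
    "attracting_neighborhood T X2 \<phi>2 U2" "A2 = snd.omega U2"
    using assms unfolding Att_def by blast
  have "A1 \<times> A2 = prod.omega (U1 \<times> U2)"
    unfolding U(2,4)
    by (rule omega_limit_Times[symmetric])
      (use U fst.omega_subset_attracting_neighborhood snd.omega_subset_attracting_neighborhood
        in \<open>auto simp: attracting_neighborhood_def\<close>)
  then show ?thesis unfolding Att_def using attracting_neighborhood_Times U by blast
qed

lemma meet_Times:
  assumes "A1 \<in> Att T X1 \<phi>1" "B1 \<in> Att T X1 \<phi>1" "A2 \<in> Att T X2 \<phi>2" "B2 \<in> Att T X2 \<phi>2"
  shows "prod.omega ((A1 \<times> A2) \<inter> (B1 \<times> B2)) = fst.omega (A1 \<inter> B1) \<times> snd.omega (A2 \<inter> B2)"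
  unfolding Times_Int_Times
proof (rule omega_limit_Times)
  show "A1 \<inter> B1 \<subseteq> X1" "A2 \<inter> B2 \<subseteq> X2" using fst.Att_subset snd.Att_subset assms by blast+
qed (use assms fst.omega_Att_Int_subset snd.omega_Att_Int_subset in blast)+

end

theorem proposition4p3:
  fixes T :: "real set"
    and X1 :: "'a::metric_space set" and X2 :: "'b::metric_space set"
    and \<phi>1 :: "real \<Rightarrow> 'a \<Rightarrow> 'a" and \<phi>2 :: "real \<Rightarrow> 'b \<Rightarrow> 'b"
    and \<Phi> :: "real \<Rightarrow> 'a \<times> 'b \<Rightarrow> 'a \<times> 'b"
    and L1 L2 Lmeet :: "('a \<times> 'b) set set"
  assumes "T = \<int> \<or> T = UNIV"
    and "compact X1" and "compact X2"
    and "dynamical_system T X1 \<phi>1" and "dynamical_system T X2 \<phi>2"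
    and "\<Phi> = product_system \<phi>1 \<phi>2"
    and "L1 = {A1 \<times> Inv T \<phi>2 X2 |A1. A1 \<in> Att T X1 \<phi>1}"
    and "L2 = {Inv T \<phi>1 X1 \<times> A2 |A2. A2 \<in> Att T X2 \<phi>2}"
    and "Lmeet = {A1 \<times> A2 |A1 A2. A1 \<in> Att T X1 \<phi>1 \<and> A2 \<in> Att T X2 \<phi>2}"
  shows "att_sublattice T (X1 \<times> X2) \<Phi> (finite_joins Lmeet) \<and>
         finite_joins Lmeet = att_sublattice T (X1 \<times> X2) \<Phi> hull (L1 \<union> L2)"
proof -
  interpret product_of_compact_systems T X1 X2 \<phi>1 \<phi>2
    using assms by unfold_locales
  let ?X = "X1 \<times> X2"
  have Lmeet: "A1 \<times> A2 \<in> Lmeet" if "A1 \<in> Att T X1 \<phi>1" "A2 \<in> Att T X2 \<phi>2" for A1 A2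
    using that assms(9) by blast
  have sub: "att_sublattice T ?X \<Phi> (finite_joins Lmeet)"
    unfolding \<open>\<Phi> = product_system \<phi>1 \<phi>2\<close>
  proof (rule prod.att_sublattice_finite_joins)
    show "Lmeet \<subseteq> Att T ?X (product_system \<phi>1 \<phi>2)" using assms(9) Att_Times by blast
    show "Inv T (product_system \<phi>1 \<phi>2) ?X \<in> Lmeet"
      unfolding Inv_Times by (intro Lmeet fst.Att_Inv_space snd.Att_Inv_space)
    fix A B assume "A \<in> Lmeet" "B \<in> Lmeet"
    then obtain A1 A2 B1 B2 where
      "A1 \<in> Att T X1 \<phi>1" "A2 \<in> Att T X2 \<phi>2" "A = A1 \<times> A2"
      "B1 \<in> Att T X1 \<phi>1" "B2 \<in> Att T X2 \<phi>2" "B = B1 \<times> B2"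
      using assms(9) by blast
    then show "prod.omega (A \<inter> B) \<in> Lmeet"
      using Lmeet fst.Att_meet snd.Att_meet by (simp add: meet_Times)
  qed
  have "L1 \<union> L2 \<subseteq> Lmeet"
    using assms(7,8) Lmeet fst.Att_Inv_space snd.Att_Inv_space by blast
  then have gens: "L1 \<union> L2 \<subseteq> finite_joins Lmeet" using finite_joins_incl by blast
  have least: "finite_joins Lmeet \<subseteq> S" if S: "L1 \<union> L2 \<subseteq> S" "att_sublattice T ?X \<Phi> S" for S
  proof (rule finite_joins_subset[OF S(2)], rule subsetI)
    fix A assume "A \<in> Lmeet"
    then obtain A1 A2 where A: "A1 \<in> Att T X1 \<phi>1" "A2 \<in> Att T X2 \<phi>2" "A = A1 \<times> A2"
      using assms(9) by blast
    have "(A1 \<times> Inv T \<phi>2 X2) \<inter> (Inv T \<phi>1 X1 \<times> A2) = A"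
      using A fst.Att_subset_Inv_space snd.Att_subset_Inv_space by blast
    then have "att_meet T ?X \<Phi> (A1 \<times> Inv T \<phi>2 X2) (Inv T \<phi>1 X1 \<times> A2) = A"
      using A assms(6) by (simp add: att_meet_def prod.Att_omega Att_Times)
    moreover have "A1 \<times> Inv T \<phi>2 X2 \<in> S" "Inv T \<phi>1 X1 \<times> A2 \<in> S"
      using S(1) A assms(7,8) by blast+
    ultimately show "A \<in> S" using S(2) unfolding att_sublattice_def by metis
  qed
  have "att_sublattice T ?X \<Phi> hull (L1 \<union> L2) = finite_joins Lmeet"
    by (rule hull_unique) (fact gens sub | erule (1) least)+
  then show ?thesis using sub by simp
qed

end
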